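(* Let $d,N\ge 1$, let $X_1,\dots,X_N\in\mathbb{R}^d$ and let $\ell_N$, $\delta\ell_N$ be as defined in the context. The following hold. 1. (Existence) The minimization problem $\min_{\rho\in\mathcal{P}(\mathbb{R}^d)}\ell_N(\rho)$ has a minimizer. 2. (Optimality condition) A distribution $\widehat\rho\in\mathcal{P}(\mathbb{R}^d)$ is a minimizer of $\ell_N$ over $\mathcal{P}(\mathbb{R}^d)$ (that is, an NPMLE) if and only if (i) $\delta\ell_N(\widehat\rho)(x)\ge -1$ for all $x\in\mathbb{R}^d$, and (ii) $\delta\ell_N(\widehat\rho)(x)=-1$ for $\widehat\rho$-a.e. $x$.
   Context: $\mathcal{P}(\mathbb{R}^d)$ is the set of Borel probability measures on $\mathbb{R}^d$. $\phi(x)=(2\pi)^{-d/2}\exp(-\|x\|_2^2/2)$ is the standard Gaussian density on $\mathbb{R}^d$. For $\rho\in\mathcal{P}(\mathbb{R}^d)$, $(\rho*\phi)(x)=\int_{\mathbb{R}^d}\phi(x-y)\,\rho(\mathrm{d}y)$. The negative log-likelihood of the data is $\ell_N(\rho)=-\frac1N\sum_{i=1}^N\log[(\rho*\phi)(X_i)]$, and its first variation at $\rho$ is the function $\delta\ell_N(\rho)(x)=-\frac1N\sum_{i=1}^N\frac{\phi(x-X_i)}{(\rho*\phi)(X_i)}$, $x\in\mathbb{R}^d$. An NPMLE (nonparametric maximum likelihood estimator) is any minimizer of $\ell_N$ over $\mathcal{P}(\mathbb{R}^d)$. *)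

theory Defs
  imports "HOL-Probability.Probability"
begin

definition borel_prob_measures :: "(real ^ 'd) measure set" where
  "borel_prob_measures = {\<rho>. prob_space \<rho> \<and> sets \<rho> = sets borel}"

definition gauss_density :: "real ^ 'd \<Rightarrow> real" where
  "gauss_density x = (2 * pi) powr (- (real CARD('d) / 2)) * exp (- (norm x)\<^sup>2 / 2)"

definition gauss_conv :: "(real ^ 'd) measure \<Rightarrow> real ^ 'd \<Rightarrow> real" where
  "gauss_conv \<rho> x = (\<integral>y. gauss_density (x - y) \<partial>\<rho>)"

text \<open>The data points are \<open>X 1, \<dots>, X N\<close>; values of \<open>X\<close> at other indices are irrelevant.\<close>

definition neg_log_lik :: "nat \<Rightarrow> (nat \<Rightarrow> real ^ 'd) \<Rightarrow> (real ^ 'd) measure \<Rightarrow> real" where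
  "neg_log_lik N X \<rho> = - (1 / real N) * (\<Sum>i=1..N. ln (gauss_conv \<rho> (X i)))"

definition first_variation ::
    "nat \<Rightarrow> (nat \<Rightarrow> real ^ 'd) \<Rightarrow> (real ^ 'd) measure \<Rightarrow> real ^ 'd \<Rightarrow> real" where
  "first_variation N X \<rho> x =
     - (1 / real N) * (\<Sum>i=1..N. gauss_density (x - X i) / gauss_conv \<rho> (X i))"

definition is_NPMLE :: "nat \<Rightarrow> (nat \<Rightarrow> real ^ 'd) \<Rightarrow> (real ^ 'd) measure \<Rightarrow> bool" where
  "is_NPMLE N X \<rho> \<longleftrightarrow> is_arg_min (neg_log_lik N X) (\<lambda>\<mu>. \<mu> \<in> borel_prob_measures) \<rho>"

end

theory Submission
  imports Defs
begin

text \<open>Mixtures with at most \<open>N + 1\<close> atoms in the convex hull of the data form a compact family, so the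
  likelihood has a maximizer \<open>\<rho>\<close> among them. Adding an atom never beats \<open>\<rho>\<close>: by Caratheodory's argument
  applied to the \<open>N\<close> likelihood values and the total mass, one atom can be removed again, and projecting
  an atom onto the convex hull moves it closer to every data point. Hence \<open>\<rho>\<close> satisfies (i).
  Integrating (i) against any \<open>\<mu>\<close> bounds the sum of the ratios
  \<open>(\<mu> * \<phi>)(X i) / (\<rho> * \<phi>)(X i)\<close> by \<open>N\<close>, and \<open>ln r \<le> r - 1\<close> gives global minimality. The equality case
  \<open>r = 1\<close> shows that all minimizers have the same likelihood values and hence the same first variation,
  so every minimizer satisfies (i). Finally the first variation at \<open>\<rho>\<close> always has \<open>\<rho>\<close>-mean \<open>-1\<close>,
  which turns (i) into (ii).\<close>

section \<open>Reducing the number of atoms\<close>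

text \<open>Gaussian elimination, by induction on the number of equations: an equation with zero
  coefficients on \<open>K\<close> is skipped, any other one is used to eliminate a pivot unknown
  \<open>p\<close>.\<close>

lemma underdetermined_system_nontrivial:
  fixes f :: "nat \<Rightarrow> 'k \<Rightarrow> real"
  assumes "finite K" "n < card K"
  shows "\<exists>c. (\<exists>k\<in>K. c k \<noteq> 0) \<and> (\<forall>i<n. (\<Sum>k\<in>K. c k * f i k) = 0)"
  using assms
proof (induction n arbitrary: K f)
  case 0
  then have "K \<noteq> {}" by auto
  then show ?case by (intro exI[of _ "\<lambda>_. 1"]) auto
next
  case (Suc n)
  show ?case
  proof (cases "\<forall>k\<in>K. f n k = 0")
    case True
    obtain c where "\<exists>k\<in>K. c k \<noteq> 0" "\<forall>i<n. (\<Sum>k\<in>K. c k * f i k) = 0"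
      using Suc.IH[of K f] Suc.prems by auto
    then show ?thesis
      using True by (intro exI[of _ c]) (auto simp: less_Suc_eq)
  next
    case False
    then obtain p where p: "p \<in> K" "f n p \<noteq> 0" by auto
    define K' where "K' = K - {p}"
    have K': "finite K'" "n < card K'" "p \<notin> K'" "K = insert p K'"
      using Suc.prems p by (auto simp: K'_def)
    obtain c where c: "\<exists>k\<in>K'. c k \<noteq> 0"
      "\<And>i. i < n \<Longrightarrow> (\<Sum>k\<in>K'. c k * (f i k - f i p * f n k / f n p)) = 0"
      using Suc.IH[of K' "\<lambda>i k. f i k - f i p * f n k / f n p"] K' by blast
    define S where "S = (\<Sum>k\<in>K'. c k * f n k)"
    \<comment> \<open>Back substitution: this entry at \<open>p\<close> makes equation
      \<open>n\<close> hold, and the reduced equations solved by \<open>c\<close> then become the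
      original ones.\<close>
    define d where "d = c(p := - S / f n p)"
    have split: "(\<Sum>k\<in>K. d k * f i k) = - S / f n p * f i p + (\<Sum>k\<in>K'. c k * f i k)" for i
    proof -
      have "(\<Sum>k\<in>K'. d k * f i k) = (\<Sum>k\<in>K'. c k * f i k)"
        using K' by (intro sum.cong) (auto simp: d_def)
      then show ?thesis using K' by (simp add: d_def)
    qed
    have "(\<Sum>k\<in>K. d k * f i k) = 0" if "i < Suc n" for i
    proof (cases "i = n")
      case True
      then show ?thesis using split[of n] p by (simp add: S_def)
    next
      case False
      with that have "i < n" by simp
      have "(\<Sum>k\<in>K'. c k * (f i k - f i p * f n k / f n p))
          = (\<Sum>k\<in>K'. c k * f i k) - f i p / f n p * S"
        by (simp add: S_def algebra_simps sum_subtractf sum_distrib_left sum_divide_distrib)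
      then show ?thesis using c(2)[OF \<open>i < n\<close>] split[of i] by (simp add: mult.commute)
    qed
    moreover have "\<exists>k\<in>K. d k \<noteq> 0"
      using c(1) K' by (auto simp: d_def)
    ultimately show ?thesis by blast
  qed
qed

text \<open>Moving \<open>w\<close> along a nonzero kernel vector changes none of the
  \<open>n\<close> sums; the motion stops when the first weight reaches zero. The weights need no
  normalization, since total mass can be one of the rows of \<open>f\<close>.\<close>

lemma conic_caratheodory_step:
  fixes f :: "nat \<Rightarrow> 'k \<Rightarrow> real"
  assumes K: "finite K" "n < card K" and w: "\<And>k. k \<in> K \<Longrightarrow> 0 \<le> w k"
  shows "\<exists>j\<in>K. \<exists>v. v j = 0 \<and> (\<forall>k\<in>K. 0 \<le> v k) \<and>
    (\<forall>i<n. (\<Sum>k\<in>K. v k * f i k) = (\<Sum>k\<in>K. w k * f i k))"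
proof -
  obtain c0 where c0: "\<exists>k\<in>K. c0 k \<noteq> 0" "\<forall>i<n. (\<Sum>k\<in>K. c0 k * f i k) = 0"
    using underdetermined_system_nontrivial[OF K] by blast
  \<comment> \<open>The sign is chosen so that some entry is positive, hence subtracting multiples
    of \<open>c\<close> must eventually exhaust a weight.\<close>
  define c where "c = (if \<exists>k\<in>K. 0 < c0 k then c0 else (\<lambda>k. - c0 k))"
  have c: "\<exists>k\<in>K. 0 < c k"
    using c0(1) by (auto simp: c_def) (meson linorder_neqE_linordered_idom)
  have c_sum: "(\<Sum>k\<in>K. c k * f i k) = 0" if "i < n" for i
    using c0(2) that by (auto simp: c_def sum_negf)
  define P where "P = {k\<in>K. 0 < c k}"
  have P: "finite P" "P \<noteq> {}" using K c by (auto simp: P_def)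
  \<comment> \<open>The index with the smallest ratio is the first to vanish, so all other weights
    are still nonnegative at that moment.\<close>
  define j where "j = arg_min_on (\<lambda>k. w k / c k) P"
  have j: "j \<in> P" "\<And>k. k \<in> P \<Longrightarrow> w j / c j \<le> w k / c k"
    using arg_min_if_finite(1)[OF P] arg_min_least[OF P] by (auto simp: j_def)
  define s where "s = w j / c j"
  have s: "0 \<le> s" using j(1) w by (auto simp: s_def P_def)
  define v where "v = (\<lambda>k. w k - s * c k)"
  have "v j = 0" using j(1) by (auto simp: v_def s_def P_def)
  moreover have "0 \<le> v k" if "k \<in> K" for k
  proof (cases "0 < c k")
    case True
    then have "s \<le> w k / c k" using j(2)[of k] that by (simp add: s_def P_def)
    then show ?thesis using True by (simp add: v_def pos_le_divide_eq)
  next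
    case False
    then have "s * c k \<le> 0" using s by (simp add: mult_nonneg_nonpos)
    then show ?thesis using w[OF that] by (simp add: v_def)
  qed
  moreover have "(\<Sum>k\<in>K. v k * f i k) = (\<Sum>k\<in>K. w k * f i k)" if "i < n" for i
  proof -
    have "(\<Sum>k\<in>K. v k * f i k) = (\<Sum>k\<in>K. w k * f i k) - s * (\<Sum>k\<in>K. c k * f i k)"
      by (simp add: v_def algebra_simps sum_subtractf sum_distrib_left)
    then show ?thesis using c_sum[OF that] by simp
  qed
  moreover have "j \<in> K" using j(1) by (simp add: P_def)
  ultimately show ?thesis by blast
qed

section \<open>Finite mixtures\<close>

text \<open>Weights may vanish and atoms may coincide, so \<open>m\<close> only bounds the number of
  atoms. This keeps the family closed under limits when \<open>C\<close> is compact.\<close>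

definition finite_mixture :: "'a set \<Rightarrow> nat \<Rightarrow> (nat \<Rightarrow> real) \<Rightarrow> (nat \<Rightarrow> 'a) \<Rightarrow> bool" where
  "finite_mixture C m w x \<longleftrightarrow> (\<forall>k<m. 0 \<le> w k \<and> x k \<in> C) \<and> (\<Sum>k<m. w k) = 1"

lemma finite_mixture_pos:
  fixes h :: "'a \<Rightarrow> real"
  assumes "finite_mixture C m w x" "\<And>y. y \<in> C \<Longrightarrow> 0 < h y"
  shows "0 < (\<Sum>k<m. w k * h (x k))"
proof -
  have "\<exists>k<m. w k \<noteq> 0"
    using assms(1) unfolding finite_mixture_def
    by (metis lessThan_iff sum.neutral zero_neq_one)
  then obtain k where "k < m" "w k \<noteq> 0" by auto
  then show ?thesis
    using assms by (intro sum_pos2[of _ k]) (auto simp: finite_mixture_def less_le)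
qed

text \<open>There are \<open>Suc N\<close> linear quantities to preserve, the total mass and the
  \<open>N\<close> values of \<open>g\<close>, which is one fewer than the number of atoms.\<close>

lemma finite_mixture_drop_atom:
  fixes g :: "nat \<Rightarrow> 'a \<Rightarrow> real"
  assumes "finite_mixture C (Suc (Suc N)) w x"
  shows "\<exists>v y. finite_mixture C (Suc N) v y \<and>
    (\<forall>i\<in>{1..N}. (\<Sum>k<Suc N. v k * g i (y k)) = (\<Sum>k<Suc (Suc N). w k * g i (x k)))"
proof -
  let ?K = "{..<Suc (Suc N)}"
  \<comment> \<open>The data indices start at 1, so row 0 is free to carry the total mass.\<close>
  let ?f = "\<lambda>i k. if i = 0 then 1 else g i (x k)"
  obtain j v where j: "j \<in> ?K" "v j = 0" "\<forall>k\<in>?K. 0 \<le> v k"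
    and v: "\<forall>i<Suc N. (\<Sum>k\<in>?K. v k * ?f i k) = (\<Sum>k\<in>?K. w k * ?f i k)"
    using conic_caratheodory_step[of ?K "Suc N" w ?f] assms
    unfolding finite_mixture_def by auto
  have "card {..<Suc N} = card (?K - {j})" using j(1) by simp
  then obtain b where b: "bij_betw b {..<Suc N} (?K - {j})"
    using finite_same_card_bij[of "{..<Suc N}" "?K - {j}"] by auto
  have reindex: "(\<Sum>k<Suc N. v (b k) * h (b k)) = (\<Sum>k\<in>?K. v k * h k)" for h :: "nat \<Rightarrow> real"
  proof -
    have "(\<Sum>k<Suc N. v (b k) * h (b k)) = (\<Sum>k\<in>?K - {j}. v k * h k)"
      using sum.reindex_bij_betw[OF b, of "\<lambda>k. v k * h k"] .
    also have "\<dots> = (\<Sum>k\<in>?K. v k * h k)"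
      using j by (intro sum.mono_neutral_left) auto
    finally show ?thesis .
  qed
  have "(\<Sum>k<Suc N. v (b k)) = 1"
    using reindex[of "\<lambda>_. 1"] v[rule_format, of 0] assms
    by (simp add: finite_mixture_def del: sum.lessThan_Suc)
  moreover have "b k \<in> ?K" if "k < Suc N" for k
    using b that by (auto simp: bij_betw_def)
  ultimately have "finite_mixture C (Suc N) (v \<circ> b) (x \<circ> b)"
    using j(3) assms by (simp add: finite_mixture_def del: sum.lessThan_Suc)
  moreover have "(\<Sum>k<Suc N. (v \<circ> b) k * g i ((x \<circ> b) k)) = (\<Sum>k<Suc (Suc N). w k * g i (x k))"
    if "i \<in> {1..N}" for i
    using reindex[of "\<lambda>k. g i (x k)"] v[rule_format, of i] that
    by (auto simp del: sum.lessThan_Suc)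
  ultimately show ?thesis by blast
qed

lemma finite_mixture_maximizer:
  fixes g :: "nat \<Rightarrow> 'a::t2_space \<Rightarrow> real"
  assumes C: "compact C" "C \<noteq> {}" and m: "0 < m"
    and cont: "\<And>i. continuous_on C (g i)" and pos: "\<And>i y. y \<in> C \<Longrightarrow> 0 < g i y"
  shows "\<exists>w x. finite_mixture C m w x \<and> (\<forall>v y. finite_mixture C m v y \<longrightarrow>
    (\<Sum>i=1..N. ln (\<Sum>k<m. v k * g i (y k))) \<le> (\<Sum>i=1..N. ln (\<Sum>k<m. w k * g i (x k))))"
proof -
  obtain a where a: "a \<in> C" using C by auto
  \<comment> \<open>Mixtures are encoded as infinite sequences of (weight, atom) pairs. Freezing the
    entries from \<open>m\<close> on makes every factor compact, so Tychonoff's theorem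
    applies.\<close>
  define S where "S = (\<lambda>k. if k < m then {0..1::real} \<times> C else {(0, a)})"
  define T where "T = PiE UNIV S \<inter> {p. (\<Sum>k<m. fst (p k)) = 1}"
  define F where "F = (\<lambda>p. \<Sum>i=1..N. ln (\<Sum>k<m. fst (p k) * g i (snd (p k))))"
  have "compactin (product_topology (\<lambda>_. euclidean) UNIV) (PiE UNIV S)"
    using C by (subst compactin_PiE) (auto simp: S_def intro!: compact_Times)
  then have "compact (PiE UNIV S)"
    by (simp add: euclidean_product_topology)
  moreover have coord: "continuous_on A (\<lambda>p. p k)" for A :: "(nat \<Rightarrow> real \<times> 'a) set" and k
    by (rule continuous_on_product_then_coordinatewise[OF continuous_on_id])
  moreover have "closed {p :: nat \<Rightarrow> real \<times> 'a. (\<Sum>k<m. fst (p k)) = 1}"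
    by (intro closed_Collect_eq continuous_intros coord)
  ultimately have T: "compact T"
    unfolding T_def by (intro compact_Int_closed)
  have T_mix: "finite_mixture C m (\<lambda>k. fst (p k)) (\<lambda>k. snd (p k))" if "p \<in> T" for p
  proof -
    have "p k \<in> {0..1} \<times> C" if "k < m" for k
      using \<open>p \<in> T\<close> that by (auto simp: T_def S_def PiE_def Pi_def dest!: spec[of _ k])
    then show ?thesis using that by (auto simp: T_def finite_mixture_def mem_Times_iff)
  qed
  define enc where "enc = (\<lambda>(v::nat \<Rightarrow> real) (y::nat \<Rightarrow> 'a) k. if k < m then (v k, y k) else (0, a))"
  have enc_T: "enc v y \<in> T" if "finite_mixture C m v y" for v y
  proof -
    have "v k \<le> 1" if "k < m" for k
      using \<open>finite_mixture C m v y\<close> that member_le_sum[of k "{..<m}" v]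
      by (auto simp: finite_mixture_def)
    then show ?thesis using that
      by (auto simp: T_def S_def enc_def finite_mixture_def)
  qed
  have "finite_mixture C m (\<lambda>k. if k = 0 then 1 else 0) (\<lambda>_. a)"
    using m a by (simp add: finite_mixture_def)
  then have "T \<noteq> {}" using enc_T by blast
  have "continuous_on T (\<lambda>p. g i (snd (p k)))" if "k < m" for i k
    by (rule continuous_on_compose2[OF cont[of i] continuous_on_snd[OF coord]])
       (use T_mix that in \<open>auto simp: finite_mixture_def\<close>)
  moreover have "(\<Sum>k<m. fst (p k) * g i (snd (p k))) \<noteq> 0" if "p \<in> T" for p i
    using finite_mixture_pos[OF T_mix[OF that], of "g i"] pos by fastforce
  ultimately have "continuous_on T F"
    unfolding F_def
    by (intro continuous_on_sum continuous_on_ln continuous_on_mult continuous_on_fst coord) auto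
  then obtain p where p: "p \<in> T" "\<forall>q\<in>T. F q \<le> F p"
    using continuous_attains_sup[OF T \<open>T \<noteq> {}\<close>] by blast
  have "F (enc v y) = (\<Sum>i=1..N. ln (\<Sum>k<m. v k * g i (y k)))" for v y
    by (simp add: F_def enc_def)
  then have "(\<Sum>i=1..N. ln (\<Sum>k<m. v k * g i (y k))) \<le> F p" if "finite_mixture C m v y" for v y
    using p(2) enc_T[OF that] by metis
  then show ?thesis using T_mix[OF p(1)] unfolding F_def by blast
qed

text \<open>First-order condition at an endpoint of a segment: the derivative at
  \<open>t = 0\<close> is the sum of \<open>v i / u i - 1\<close>, and a positive value would
  contradict maximality for small \<open>t\<close>.\<close>

lemma sum_ln_segment_max:
  fixes u v :: "'i \<Rightarrow> real"
  assumes u: "\<And>i. i \<in> I \<Longrightarrow> 0 < u i"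
    and max: "\<And>t. 0 < t \<Longrightarrow> t < 1 \<Longrightarrow>
      (\<Sum>i\<in>I. ln ((1 - t) * u i + t * v i)) \<le> (\<Sum>i\<in>I. ln (u i))"
  shows "(\<Sum>i\<in>I. v i / u i) \<le> card I"
proof (rule ccontr)
  assume *: "\<not> ?thesis"
  let ?h = "\<lambda>t. \<Sum>i\<in>I. ln ((1 - t) * u i + t * v i)"
  have "((\<lambda>t. ln ((1 - t) * u i + t * v i)) has_real_derivative (v i / u i - 1)) (at 0)"
    if "i \<in> I" for i
    using u[OF that] by (auto intro!: derivative_eq_intros simp: field_simps)
  then have "(?h has_real_derivative (\<Sum>i\<in>I. v i / u i - 1)) (at 0)"
    by (intro DERIV_sum) auto
  moreover have "0 < (\<Sum>i\<in>I. v i / u i - 1)"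
    using * by (simp add: sum_subtractf)
  ultimately obtain d where d: "d > 0" "\<And>h. 0 < h \<Longrightarrow> h < d \<Longrightarrow> ?h 0 < ?h (0 + h)"
    using DERIV_pos_inc_right by blast
  define t where "t = min (d / 2) (1 / 2)"
  have "0 < t" "t < 1" "t < d" using d(1) by (auto simp: t_def min_less_iff_disj)
  then show False using d(2)[of t] max[of t] by simp
qed

lemma finite_mixture_optimum:
  fixes g :: "nat \<Rightarrow> 'a::t2_space \<Rightarrow> real"
  assumes C: "compact C" "C \<noteq> {}"
    and cont: "\<And>i. continuous_on C (g i)" and pos: "\<And>i y. y \<in> C \<Longrightarrow> 0 < g i y"
  shows "\<exists>w x. finite_mixture C (Suc N) w x \<and>
    (\<forall>y\<in>C. (\<Sum>i=1..N. g i y / (\<Sum>k<Suc N. w k * g i (x k))) \<le> real N)"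
proof -
  obtain w x where wx: "finite_mixture C (Suc N) w x"
    and max: "\<And>v y. finite_mixture C (Suc N) v y \<Longrightarrow>
      (\<Sum>i=1..N. ln (\<Sum>k<Suc N. v k * g i (y k))) \<le> (\<Sum>i=1..N. ln (\<Sum>k<Suc N. w k * g i (x k)))"
    using finite_mixture_maximizer[where g = g, OF C zero_less_Suc cont pos] by blast
  let ?u = "\<lambda>i. \<Sum>k<Suc N. w k * g i (x k)"
  have "(\<Sum>i=1..N. g i y / ?u i) \<le> real (card {1..N})" if y: "y \<in> C" for y
  proof (rule sum_ln_segment_max)
    show "0 < ?u i" for i
      using finite_mixture_pos[OF wx pos] .
  next
    fix t :: real assume t: "0 < t" "t < 1"
    \<comment> \<open>The competitor mixes the optimum with a point mass at \<open>y\<close>, stored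
      at the new index \<open>Suc N\<close>. It has one atom too many for \<open>max\<close>, so an
      atom must be dropped first.\<close>
    define w' where "w' = (\<lambda>k. if k < Suc N then (1 - t) * w k else t)"
    define x' where "x' = (\<lambda>k. if k < Suc N then x k else y)"
    have sum': "(\<Sum>k<Suc (Suc N). w' k * h (x' k)) = (1 - t) * (\<Sum>k<Suc N. w k * h (x k)) + t * h y"
      for h :: "'a \<Rightarrow> real"
      by (subst sum.lessThan_Suc) (simp add: w'_def x'_def sum_distrib_left mult.assoc del: sum.lessThan_Suc)
    have "finite_mixture C (Suc (Suc N)) w' x'"
      using wx t y sum'[of "\<lambda>_. 1"] unfolding finite_mixture_def
      by (auto simp: w'_def x'_def simp del: sum.lessThan_Suc)
    from finite_mixture_drop_atom[OF this, of g] obtain v z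
      where vz: "finite_mixture C (Suc N) v z"
        "\<And>i. i \<in> {1..N} \<Longrightarrow>
          (\<Sum>k<Suc N. v k * g i (z k)) = (\<Sum>k<Suc (Suc N). w' k * g i (x' k))"
      by blast
    have "(\<Sum>i=1..N. ln ((1 - t) * ?u i + t * g i y)) = (\<Sum>i=1..N. ln (\<Sum>k<Suc N. v k * g i (z k)))"
      using vz(2) sum' by (intro sum.cong) (simp_all del: sum.lessThan_Suc)
    also have "\<dots> \<le> (\<Sum>i=1..N. ln (?u i))"
      by (rule max[OF vz(1)])
    finally show "(\<Sum>i=1..N. ln ((1 - t) * ?u i + t * g i y)) \<le> (\<Sum>i=1..N. ln (?u i))" .
  qed
  then show ?thesis using wx by (intro exI conjI ballI) (simp_all del: sum.lessThan_Suc)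
qed

text \<open>Pushing forward a measure on the indices adds up the weights of coinciding atoms without
  a case distinction.\<close>

definition mixture_measure :: "nat \<Rightarrow> (nat \<Rightarrow> real) \<Rightarrow> (nat \<Rightarrow> 'a::topological_space) \<Rightarrow> 'a measure" where
  "mixture_measure m w x = distr (point_measure {..<m} (\<lambda>k. ennreal (w k))) borel x"

lemma prob_space_mixture_measure:
  assumes "finite_mixture C m w x"
  shows "prob_space (mixture_measure m w x)"
  unfolding mixture_measure_def
proof (rule prob_space.prob_space_distr)
  have "(\<Sum>k<m. ennreal (w k)) = ennreal (\<Sum>k<m. w k)"
    using assms by (intro sum_ennreal) (simp add: finite_mixture_def)
  then show "prob_space (point_measure {..<m} (\<lambda>k. ennreal (w k)))"
    using assms
    by (intro prob_spaceI)
       (simp add: space_point_measure emeasure_point_measure_finite finite_mixture_def)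
qed simp

lemma integral_mixture_measure:
  fixes h :: "'a::topological_space \<Rightarrow> real"
  assumes "finite_mixture C m w x" "h \<in> borel_measurable borel"
  shows "(\<integral>y. h y \<partial>mixture_measure m w x) = (\<Sum>k<m. w k * h (x k))"
  unfolding mixture_measure_def using assms
  by (subst integral_distr, simp, simp, subst lebesgue_integral_point_measure_finite)
     (auto simp: finite_mixture_def)

section \<open>Gaussian convolutions and the first variation\<close>

lemma gauss_density_pos: "0 < gauss_density x"
  by (simp add: gauss_density_def)

lemma gauss_density_commute: "gauss_density (x - y) = gauss_density (y - x)"
  by (simp add: gauss_density_def norm_minus_commute)

lemma gauss_density_antimono:
  fixes x y :: "real ^ 'd"
  shows "norm x \<le> norm y \<Longrightarrow> gauss_density y \<le> gauss_density x"
  by (simp add: gauss_density_def mult_left_mono power_mono)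

lemma continuous_gauss_density: "continuous_on A (\<lambda>y. gauss_density (x - y))"
  unfolding gauss_density_def by (intro continuous_intros) auto

lemma measurable_gauss_density [measurable]: "(\<lambda>y. gauss_density (x - y)) \<in> borel_measurable borel"
  by (rule borel_measurable_continuous_onI[OF continuous_gauss_density])

context
  fixes \<rho> :: "(real ^ 'd) measure"
  assumes \<rho>: "\<rho> \<in> borel_prob_measures"
begin

interpretation prob_space \<rho>
  using \<rho> by (simp add: borel_prob_measures_def)

lemma integrable_gauss_density: "integrable \<rho> (\<lambda>y. gauss_density (x - y))"
proof (rule integrable_const_bound)
  show "AE y in \<rho>. norm (gauss_density (x - y)) \<le> gauss_density (0 :: real ^ 'd)"
    by (auto simp: abs_of_pos[OF gauss_density_pos] intro!: gauss_density_antimono)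
  have "sets \<rho> = sets borel" using \<rho> by (simp add: borel_prob_measures_def)
  then show "(\<lambda>y. gauss_density (x - y)) \<in> borel_measurable \<rho>"
    using measurable_gauss_density measurable_cong_sets by blast
qed

lemma gauss_conv_pos: "0 < gauss_conv \<rho> x"
proof -
  have "(\<integral>y. 0 \<partial>\<rho>) < (\<integral>y. gauss_density (x - y) \<partial>\<rho>)"
    by (rule integral_less_AE_space)
       (auto simp: integrable_gauss_density gauss_density_pos emeasure_space_1)
  then show ?thesis by (simp add: gauss_conv_def)
qed

lemma integrable_first_variation: "integrable \<rho> (first_variation N X \<mu>)"
  unfolding first_variation_def gauss_density_commute[of _ "X i" for i]
  by (intro integrable_mult_right Bochner_Integration.integrable_sum integrable_divide_zero integrable_gauss_density)

text \<open>Symmetry of the Gaussian turns each integrated kernel into a convolution at a data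
  point. Two measures are allowed: \<open>\<mu> = \<rho>\<close> gives the mean \<open>-1\<close>,
  and distinct ones compare a candidate with a competitor.\<close>

lemma integral_first_variation:
  "(\<integral>x. first_variation N X \<mu> x \<partial>\<rho>) =
    - (1 / real N) * (\<Sum>i=1..N. gauss_conv \<rho> (X i) / gauss_conv \<mu> (X i))"
  unfolding first_variation_def gauss_conv_def[of \<rho>]
  unfolding gauss_density_commute[of _ "X i" for i]
  by (simp add: integrable_gauss_density)

text \<open>Under (i), \<open>first_variation N X \<rho> x + 1\<close> is nonnegative with
  \<open>\<rho>\<close>-integral zero, hence vanishes almost everywhere.\<close>

lemma first_variation_AE_eq:
  assumes N: "N \<ge> 1" and ge: "\<And>x. first_variation N X \<rho> x \<ge> -1"
  shows "AE x in \<rho>. first_variation N X \<rho> x = -1"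
proof -
  have "(\<Sum>i=1..N. gauss_conv \<rho> (X i) / gauss_conv \<rho> (X i)) = (\<Sum>i=1..N. 1)"
    using gauss_conv_pos by (intro sum.cong) (auto simp: less_imp_neq[symmetric])
  then have "(\<integral>x. first_variation N X \<rho> x \<partial>\<rho>) = -1"
    unfolding integral_first_variation using N by simp
  then have "(\<integral>x. first_variation N X \<rho> x + 1 \<partial>\<rho>) = 0"
    by (simp add: integrable_first_variation prob_space)
  moreover have "AE x in \<rho>. 0 \<le> first_variation N X \<rho> x + 1"
    using ge by (intro AE_I2) (smt (verit))
  moreover have "integrable \<rho> (\<lambda>x. first_variation N X \<rho> x + 1)"
    by (simp add: integrable_first_variation)
  ultimately have "AE x in \<rho>. first_variation N X \<rho> x + 1 = 0"
    using integral_nonneg_eq_0_iff_AE by blast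
  then show ?thesis by eventually_elim simp
qed

lemma gauss_conv_ratio_sum_le:
  assumes N: "N \<ge> 1" and ge: "\<And>x. first_variation N X \<mu> x \<ge> -1"
  shows "(\<Sum>i=1..N. gauss_conv \<rho> (X i) / gauss_conv \<mu> (X i)) \<le> real N"
proof -
  have "(\<integral>x. -1 \<partial>\<rho>) \<le> (\<integral>x. first_variation N X \<mu> x \<partial>\<rho>)"
    by (intro integral_mono integrable_first_variation ge) auto
  then show ?thesis using N
    by (simp add: integral_first_variation prob_space field_simps)
qed

end

section \<open>Global comparison of likelihoods and the optimality criterion\<close>

lemma neg_log_lik_diff:
  assumes "\<rho> \<in> borel_prob_measures" "\<mu> \<in> borel_prob_measures"
  shows "neg_log_lik N X \<rho> - neg_log_lik N X \<mu> =
    (1 / real N) * (\<Sum>i=1..N. ln (gauss_conv \<mu> (X i) / gauss_conv \<rho> (X i)))"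
  by (simp add: neg_log_lik_def ln_div gauss_conv_pos[OF assms(1)] gauss_conv_pos[OF assms(2)]
      less_imp_neq[symmetric] sum_subtractf right_diff_distrib)

lemma neg_log_lik_le_of_first_variation:
  assumes N: "N \<ge> 1" and \<rho>: "\<rho> \<in> borel_prob_measures" and \<mu>: "\<mu> \<in> borel_prob_measures"
    and ge: "\<And>x. first_variation N X \<rho> x \<ge> -1"
  shows "neg_log_lik N X \<rho> \<le> neg_log_lik N X \<mu>"
    and "neg_log_lik N X \<rho> = neg_log_lik N X \<mu> \<Longrightarrow> i \<in> {1..N} \<Longrightarrow>
      gauss_conv \<mu> (X i) = gauss_conv \<rho> (X i)"
proof -
  define r where "r = (\<lambda>i. gauss_conv \<mu> (X i) / gauss_conv \<rho> (X i))"
  have r: "0 < r i" for i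
    using gauss_conv_pos[OF \<rho>] gauss_conv_pos[OF \<mu>] by (simp add: r_def)
  have r_sum: "(\<Sum>i=1..N. r i - 1) \<le> 0"
    using gauss_conv_ratio_sum_le[OF \<mu> N ge] by (simp add: r_def sum_subtractf)
  have diff: "neg_log_lik N X \<rho> - neg_log_lik N X \<mu> = (1 / real N) * (\<Sum>i=1..N. ln (r i))"
    unfolding r_def by (rule neg_log_lik_diff[OF \<rho> \<mu>])
  have ln_le: "ln (r i) \<le> r i - 1" for i
    using r by (rule ln_le_minus_one)
  then have "(\<Sum>i=1..N. ln (r i)) \<le> (\<Sum>i=1..N. r i - 1)"
    by (rule sum_mono)
  then have le: "(\<Sum>i=1..N. ln (r i)) \<le> 0" using r_sum by simp
  then have "(1 / real N) * (\<Sum>i=1..N. ln (r i)) \<le> 0"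
    by (simp add: mult_nonneg_nonpos divide_nonpos_nonneg)
  then show "neg_log_lik N X \<rho> \<le> neg_log_lik N X \<mu>"
    using diff by simp
  assume eq: "neg_log_lik N X \<rho> = neg_log_lik N X \<mu>" and i: "i \<in> {1..N}"
  have "(\<Sum>i=1..N. ln (r i)) = 0"
    using diff eq N by simp
  \<comment> \<open>Equal likelihoods leave no slack: a sum of nonnegative gaps is at most zero, so
    each gap is zero, which forces \<open>r i = 1\<close>.\<close>
  then have "(\<Sum>i=1..N. (r i - 1) - ln (r i)) \<le> 0"
    using r_sum by (simp only: sum_subtractf)
  then have "(\<Sum>i=1..N. (r i - 1) - ln (r i)) = 0"
    using ln_le by (intro antisym sum_nonneg) (auto simp: algebra_simps)
  then have "(r i - 1) - ln (r i) = 0"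
    using ln_le i by (subst (asm) sum_nonneg_eq_0_iff) (auto simp: algebra_simps)
  then have "r i = 1"
    using ln_eq_minus_one[OF r[of i]] by simp
  then show "gauss_conv \<mu> (X i) = gauss_conv \<rho> (X i)"
    using gauss_conv_pos[OF \<rho>, of "X i"] by (simp add: r_def)
qed

text \<open>The optimal mixture on the convex hull of the data gives the bound only for points of
  the hull; metric projection extends it to the whole space.\<close>

lemma exists_first_variation_ge:
  fixes X :: "nat \<Rightarrow> real ^ 'd"
  assumes N: "N \<ge> 1"
  shows "\<exists>\<rho>\<in>borel_prob_measures. \<forall>x. first_variation N X \<rho> x \<ge> -1"
proof -
  define C where "C = convex hull (X ` {1..N})"
  have C: "compact C" "convex C" "C \<noteq> {}" and XC: "\<And>i. i \<in> {1..N} \<Longrightarrow> X i \<in> C"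
    using N by (auto simp: C_def compact_convex_hull finite_imp_compact hull_inc)
  let ?g = "\<lambda>i y. gauss_density (X i - y)"
  obtain w x where wx: "finite_mixture C (Suc N) w x"
    and opt: "\<And>y. y \<in> C \<Longrightarrow> (\<Sum>i=1..N. ?g i y / (\<Sum>k<Suc N. w k * ?g i (x k))) \<le> real N"
    using finite_mixture_optimum[OF C(1,3), of ?g N] continuous_gauss_density gauss_density_pos
    by blast
  define \<rho> where "\<rho> = mixture_measure (Suc N) w x"
  have \<rho>: "\<rho> \<in> borel_prob_measures"
    using prob_space_mixture_measure[OF wx]
    by (simp add: \<rho>_def borel_prob_measures_def) (simp add: mixture_measure_def)
  have conv: "gauss_conv \<rho> z = (\<Sum>k<Suc N. w k * gauss_density (z - x k))" for z
    unfolding gauss_conv_def \<rho>_def by (rule integral_mixture_measure[OF wx]) simp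
  have "first_variation N X \<rho> y \<ge> -1" for y
  proof -
    let ?p = "closest_point C y"
    have p: "?p \<in> C" using C by (simp add: closest_point_in_set compact_imp_closed)
    \<comment> \<open>Projection onto a closed convex set is 1-Lipschitz and fixes the data points,
      so \<open>?p\<close> is at least as close to \<open>X i\<close> as \<open>y\<close>
      is.\<close>
    have "?g i y \<le> ?g i ?p" if "i \<in> {1..N}" for i
      using closest_point_lipschitz[OF C(2) compact_imp_closed[OF C(1)] C(3), of "X i" y]
        closest_point_self[OF XC[OF that]]
      by (intro gauss_density_antimono) (simp add: dist_norm)
    then have "(\<Sum>i=1..N. ?g i y / gauss_conv \<rho> (X i)) \<le> (\<Sum>i=1..N. ?g i ?p / gauss_conv \<rho> (X i))"
      using gauss_conv_pos[OF \<rho>] by (intro sum_mono divide_right_mono) (auto simp: less_imp_le)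
    also have "\<dots> \<le> real N"
      using opt[OF p] by (simp only: conv)
    finally show ?thesis
      using N by (simp add: first_variation_def gauss_density_commute[of y] field_simps)
  qed
  then show ?thesis using \<rho> by blast
qed

theorem theorem1:
  fixes N :: nat and X :: "nat \<Rightarrow> real ^ 'd"
  assumes "N \<ge> 1"
  shows "(\<exists>\<rho>. is_NPMLE N X \<rho>) \<and>
    (\<forall>\<rho> \<in> borel_prob_measures.
       is_NPMLE N X \<rho> \<longleftrightarrow>
         (\<forall>x. first_variation N X \<rho> x \<ge> -1) \<and>
         (AE x in \<rho>. first_variation N X \<rho> x = -1))"
proof -
  have NPMLE_iff: "is_NPMLE N X \<rho> \<longleftrightarrow> \<rho> \<in> borel_prob_measures \<and>
      (\<forall>\<mu>\<in>borel_prob_measures. neg_log_lik N X \<rho> \<le> neg_log_lik N X \<mu>)" for \<rho>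
    unfolding is_NPMLE_def is_arg_min_def by (meson not_less)
  have sufficient: "is_NPMLE N X \<rho>"
    if "\<rho> \<in> borel_prob_measures" "\<And>x. first_variation N X \<rho> x \<ge> -1" for \<rho>
    using that neg_log_lik_le_of_first_variation(1)[OF assms that(1) _ that(2)]
    by (simp add: NPMLE_iff)
  obtain \<rho>\<^sub>0 where \<rho>\<^sub>0: "\<rho>\<^sub>0 \<in> borel_prob_measures" "\<And>x. first_variation N X \<rho>\<^sub>0 x \<ge> -1"
    using exists_first_variation_ge[OF assms] by blast
  \<comment> \<open>No perturbation of \<open>\<rho>\<close> is needed: it ties with
    \<open>\<rho>\<^sub>0\<close>, so both have the same convolution values at the data, and the
    first variation depends on the measure only through these.\<close>
  have necessary: "first_variation N X \<rho> x \<ge> -1" if "is_NPMLE N X \<rho>" for \<rho> x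
  proof -
    have \<rho>: "\<rho> \<in> borel_prob_measures" using that by (simp add: NPMLE_iff)
    have "neg_log_lik N X \<rho>\<^sub>0 = neg_log_lik N X \<rho>"
      using that sufficient[OF \<rho>\<^sub>0] by (auto simp: NPMLE_iff intro: antisym)
    then have "gauss_conv \<rho> (X i) = gauss_conv \<rho>\<^sub>0 (X i)" if "i \<in> {1..N}" for i
      using neg_log_lik_le_of_first_variation(2)[OF assms \<rho>\<^sub>0(1) \<rho> \<rho>\<^sub>0(2)] that by blast
    then have "first_variation N X \<rho> x = first_variation N X \<rho>\<^sub>0 x"
      by (simp add: first_variation_def)
    then show ?thesis using \<rho>\<^sub>0(2) by simp
  qed
  show ?thesis
    using sufficient[OF \<rho>\<^sub>0] sufficient necessary first_variation_AE_eq[OF _ assms] by blast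
qed

end
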